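(* Let $M$ be an almost paracontact metric 3-dimensional Walker manifold for which $\xi_3=0$ and $\xi_2=1$. Then we have: (i) $M$ does not belong to the following classes: $\mathbb G_5$, $\mathbb G_5\oplus\mathbb G_{10}$, $\mathbb G_5\oplus\mathbb G_{12}$, $\mathbb G_5\oplus\mathbb G_{10}\oplus\mathbb G_{12}$, $\mathbb G_6$, $\mathbb G_6\oplus\mathbb G_{10}$, $\mathbb G_6\oplus\mathbb G_{12}$, $\mathbb G_6\oplus\mathbb G_{10}\oplus\mathbb G_{12}$; (ii) $M$ is paracosymplectic if and only if $(\xi_1)_x=(\xi_1)_y=0$ and $2(\xi_1)_z+\xi_1f_x+f_y=0$; (iii) $M$ is normal if and only if $(\xi_1)_x\neq0$, $(\xi_1)_y=-\xi_1(\xi_1)_x$ and $2(\xi_1)_z+\xi_1f_x+f_y+(\xi_1)_x(\xi_1^2-f)=0$; (iv) $M$ is almost paracosymplectic if and only if $(\xi_1)_x=(\xi_1)_y=0$ and $2(\xi_1)_z+\xi_1f_x+f_y\neq0$; (v) $M\in\mathbb G_{12}$ if and only if $(\xi_1)_x=0$, $(\xi_1)_y\neq0$ and $2\xi_1(\xi_1)_y-2(\xi_1)_z-\xi_1f_x-f_y=0$.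
   Context: A 3-dimensional Walker manifold is a 3-dimensional Lorentzian manifold $(M,g)$ admitting a parallel lightlike distribution of rank 1. An almost paracontact metric 3-dimensional Walker manifold $(M,\varphi,\xi,\eta,g)$ is such a manifold with the structure given, in local coordinates $(x,y,z)$ and with respect to $\{\partial_x,\partial_y,\partial_z\}$, by $$g=\begin{pmatrix}0&0&1\\0&1&0\\1&0&f\end{pmatrix},\quad \varphi=\begin{pmatrix}-\xi_2&\xi_1+f\xi_3&-f\xi_2\\ \xi_3&0&-\xi_1\\0&-\xi_3&\xi_2\end{pmatrix},$$ $\xi=\xi_1\partial_x+\xi_2\partial_y+\xi_3\partial_z$, $\eta=\xi_3dx+\xi_2dy+(\xi_1+f\xi_3)dz$, where $f=f(x,y,z)\in C^\infty(M)$ and $\xi_1,\xi_2,\xi_3\in C^\infty(M)$ satisfy $\xi_2^2+f\xi_3^2+2\xi_1\xi_3=1$ (columns of $\varphi$ are the images of the basis vectors). Subscripts $x,y,z$ on functions denote partial derivatives. Let $F(X,Y,Z)=g((\nabla_X\varphi)Y,Z)$, $\nabla$ the Levi-Civita connection; $\theta_F(X)=g^{ij}F(e_i,e_j,X)$, $\theta_F^*(X)=g^{ij}F(e_i,\varphi e_j,X)$ for a local basis $\{e_i\}$. Classes in dimension 3 ($M$ is in a class if at each point $F$ satisfies the condition): $\mathbb G_5$: $F(X,Y,Z)=\frac{\theta_F(\xi)}{2}\{\eta(Y)g(\varphi X,\varphi Z)-\eta(Z)g(\varphi X,\varphi Y)\}$; $\mathbb G_6$: $F(X,Y,Z)=-\frac{\theta^*_F(\xi)}{2}\{\eta(Y)g(X,\varphi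 Z)-\eta(Z)g(X,\varphi Y)\}$; $\mathbb G_{10}$: $F(X,Y,Z)=-\eta(Y)F(X,Z,\xi)+\eta(Z)F(X,Y,\xi)$ and $F(X,Y,\xi)=F(Y,X,\xi)=F(\varphi X,\varphi Y,\xi)$; $\mathbb G_{12}$: $F(X,Y,Z)=\eta(X)\{\eta(Y)F(\xi,\xi,Z)-\eta(Z)F(\xi,\xi,Y)\}$; $\mathbb G_0$ (the intersection of all basic classes): $F=0$. In dimension 3, $F$ decomposes uniquely as $F=F^5+F^6+F^{10}+F^{12}$ with $F^i\in\mathbb G_i$; $M\in\mathbb G_i\oplus\mathbb G_j\oplus\cdots$ means $F=F^i+F^j+\cdots$, where $F^i,F^j,\dots$ are the projections of $F$ on $\mathbb G_i,\mathbb G_j,\dots$. $M$ is normal if $N(X,Y)-2d\eta(X,Y)\xi=0$ with $N(X,Y)=\varphi^2[X,Y]+[\varphi X,\varphi Y]-\varphi[\varphi X,Y]-\varphi[X,\varphi Y]$ and $d\eta(X,Y)=\frac12((\nabla_X\eta)Y-(\nabla_Y\eta)X)$; almost paracosymplectic if $d\eta=0$ and $d\phi=0$, where $\phi(X,Y)=g(\varphi X,Y)$ (in dimension 3, equivalently $M\in\mathbb G_{10}$); paracosymplectic if it is almost paracosymplectic and normal (in dimension 3, equivalently $M\in\mathbb G_0$).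
   Formalization: As F=0 (e.g. f=ξ₁=0) refutes (i),(iii)–(v) literally, membership in a sum of classes requires each listed projection nonzero, and (iii),(iv) add "not paracosymplectic"; "≠0" is stated both as not identically and as nowhere zero; M is a coordinate domain. *)

theory Defs
  imports "HOL-Analysis.Analysis"
begin

section \<open>Calculus on a coordinate domain of three-space\<close>

type_synonym pt = "real^3"
type_synonym vfield = "pt \<Rightarrow> real^3"
type_synonym mfield = "pt \<Rightarrow> real^3^3"
type_synonym tensor3 = "real^3 \<Rightarrow> real^3 \<Rightarrow> real^3 \<Rightarrow> real"

text \<open>A point is its coordinate triple \<open>(x, y, z) = (p $ 1, p $ 2, p $ 3)\<close>; a tangent vector at a
  point is its triple of components with respect to the coordinate frame.\<close>

definition dird :: "(pt \<Rightarrow> real) \<Rightarrow> pt \<Rightarrow> real^3 \<Rightarrow> real" where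
  "dird h p v = frechet_derivative h (at p) v"

definition pd :: "3 \<Rightarrow> (pt \<Rightarrow> real) \<Rightarrow> pt \<Rightarrow> real" where
  "pd i h p = dird h p (axis i 1)"

text \<open>On an open set, being of class \<open>C\<^sup>\<infinity>\<close> is the same as all iterated partial
  derivatives (indexed by lists of coordinate directions) being totally differentiable at every
  point.\<close>

definition smooth_fun_on :: "pt set \<Rightarrow> (pt \<Rightarrow> real) \<Rightarrow> bool" where
  "smooth_fun_on U h \<longleftrightarrow> (\<forall>is. \<forall>p\<in>U. foldr pd is h differentiable (at p))"

definition smooth_vfield_on :: "pt set \<Rightarrow> vfield \<Rightarrow> bool" where
  "smooth_vfield_on U X \<longleftrightarrow> (\<forall>k. smooth_fun_on U (\<lambda>p. X p $ k))"

definition lie_bracket :: "vfield \<Rightarrow> vfield \<Rightarrow> vfield" where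
  "lie_bracket X Y p = (\<chi> k. dird (\<lambda>q. Y q $ k) p (X p) - dird (\<lambda>q. X q $ k) p (Y p))"


section \<open>Almost paracontact metric structures on a coordinate domain\<close>

text \<open>\<open>metric\<close> is the Gram matrix of \<open>g\<close>; the columns of \<open>phi\<close> are the images of the coordinate
  vector fields; \<open>xi\<close> holds components of a vector field and \<open>eta\<close> components of a 1-form.\<close>

record apm =
  points :: "pt set"
  metric :: mfield
  phi :: mfield
  xi :: vfield
  eta :: vfield

definition ip :: "apm \<Rightarrow> pt \<Rightarrow> real^3 \<Rightarrow> real^3 \<Rightarrow> real" where
  "ip M p X Y = X \<bullet> (metric M p *v Y)"

definition phi_at :: "apm \<Rightarrow> pt \<Rightarrow> real^3 \<Rightarrow> real^3" where
  "phi_at M p X = phi M p *v X"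

definition eta_at :: "apm \<Rightarrow> pt \<Rightarrow> real^3 \<Rightarrow> real" where
  "eta_at M p X = eta M p \<bullet> X"

definition ginv :: "apm \<Rightarrow> pt \<Rightarrow> 3 \<Rightarrow> 3 \<Rightarrow> real" where
  "ginv M p i j = matrix_inv (metric M p) $ i $ j"

definition christoffel :: "apm \<Rightarrow> pt \<Rightarrow> 3 \<Rightarrow> 3 \<Rightarrow> 3 \<Rightarrow> real" where
  "christoffel M p k i j = (\<Sum>l\<in>UNIV. ginv M p k l *
     (pd i (\<lambda>q. metric M q $ j $ l) p + pd j (\<lambda>q. metric M q $ i $ l) p
      - pd l (\<lambda>q. metric M q $ i $ j) p)) / 2"

text \<open>Levi-Civita connection\<close>

definition nabla :: "apm \<Rightarrow> vfield \<Rightarrow> vfield \<Rightarrow> vfield" where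
  "nabla M X Y p = (\<chi> k. dird (\<lambda>q. Y q $ k) p (X p)
     + (\<Sum>i\<in>UNIV. \<Sum>j\<in>UNIV. christoffel M p k i j * X p $ i * Y p $ j))"

definition nabla_phi :: "apm \<Rightarrow> vfield \<Rightarrow> vfield \<Rightarrow> vfield" where
  "nabla_phi M X Y p = nabla M X (\<lambda>q. phi_at M q (Y q)) p - phi_at M p (nabla M X Y p)"

definition nabla_eta :: "apm \<Rightarrow> vfield \<Rightarrow> vfield \<Rightarrow> pt \<Rightarrow> real" where
  "nabla_eta M X Y p = dird (\<lambda>q. eta_at M q (Y q)) p (X p) - eta_at M p (nabla M X Y p)"

text \<open>\<open>nabla_phi\<close> is tensorial, so tangent vectors at \<open>p\<close> may be extended to vector fields with
  constant components.\<close>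

definition F :: "apm \<Rightarrow> pt \<Rightarrow> tensor3" where
  "F M p X Y Z = ip M p (nabla_phi M (\<lambda>_. X) (\<lambda>_. Y) p) Z"


subsection \<open>The classes\<close>

definition trilinear :: "tensor3 \<Rightarrow> bool" where
  "trilinear T \<longleftrightarrow> (\<forall>Y Z. linear (\<lambda>X. T X Y Z)) \<and> (\<forall>X Z. linear (\<lambda>Y. T X Y Z))
     \<and> (\<forall>X Y. linear (\<lambda>Z. T X Y Z))"

definition theta :: "apm \<Rightarrow> pt \<Rightarrow> tensor3 \<Rightarrow> real^3 \<Rightarrow> real" where
  "theta M p T X = (\<Sum>i\<in>UNIV. \<Sum>j\<in>UNIV. ginv M p i j * T (axis i 1) (axis j 1) X)"

definition theta_star :: "apm \<Rightarrow> pt \<Rightarrow> tensor3 \<Rightarrow> real^3 \<Rightarrow> real" where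
  "theta_star M p T X =
     (\<Sum>i\<in>UNIV. \<Sum>j\<in>UNIV. ginv M p i j * T (axis i 1) (phi_at M p (axis j 1)) X)"

datatype gclass = G5 | G6 | G10 | G12

fun in_gclass :: "apm \<Rightarrow> pt \<Rightarrow> gclass \<Rightarrow> tensor3 \<Rightarrow> bool" where
  "in_gclass M p G5 T \<longleftrightarrow> trilinear T \<and>
     (\<forall>X Y Z. T X Y Z = theta M p T (xi M p) / 2 *
        (eta_at M p Y * ip M p (phi_at M p X) (phi_at M p Z)
         - eta_at M p Z * ip M p (phi_at M p X) (phi_at M p Y)))"
| "in_gclass M p G6 T \<longleftrightarrow> trilinear T \<and>
     (\<forall>X Y Z. T X Y Z = - (theta_star M p T (xi M p) / 2) *
        (eta_at M p Y * ip M p X (phi_at M p Z) - eta_at M p Z * ip M p X (phi_at M p Y)))"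
| "in_gclass M p G10 T \<longleftrightarrow> trilinear T \<and>
     (\<forall>X Y Z. T X Y Z = - eta_at M p Y * T X Z (xi M p) + eta_at M p Z * T X Y (xi M p)) \<and>
     (\<forall>X Y. T X Y (xi M p) = T Y X (xi M p)
        \<and> T Y X (xi M p) = T (phi_at M p X) (phi_at M p Y) (xi M p))"
| "in_gclass M p G12 T \<longleftrightarrow> trilinear T \<and>
     (\<forall>X Y Z. T X Y Z = eta_at M p X *
        (eta_at M p Y * T (xi M p) (xi M p) Z - eta_at M p Z * T (xi M p) (xi M p) Y))"

text \<open>\<open>is_decomp M S C\<close>: \<open>F\<close> is, at every point, the sum of the components \<open>C p i\<close> lying in the
  classes \<open>i \<in> S\<close>. Since the four classes are independent, \<open>C p i\<close> is then the projection of \<open>F\<close> at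
  \<open>p\<close> on the class \<open>i\<close>.\<close>

definition is_decomp :: "apm \<Rightarrow> gclass set \<Rightarrow> (pt \<Rightarrow> gclass \<Rightarrow> tensor3) \<Rightarrow> bool" where
  "is_decomp M S C \<longleftrightarrow>
     (\<forall>p\<in>points M. \<forall>i\<in>S. in_gclass M p i (C p i)) \<and>
     (\<forall>p\<in>points M. \<forall>X Y Z. F M p X Y Z = (\<Sum>i\<in>S. C p i X Y Z))"

text \<open>Membership in the direct sum of the classes in \<open>S\<close> (which is the class \<open>G\<^sub>0\<close> if \<open>S\<close> is
  empty) is understood in the sense of a classification: the sum really involves each of the classes
  in \<open>S\<close>. Otherwise \<open>F = 0\<close> would count as a member of every class. ``Nonzero'' can mean that the
  projection, as a tensor field, is not identically zero (\<open>belongs\<close>) or that it vanishes at no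
  point (\<open>belongs_everywhere\<close>).\<close>

definition belongs :: "apm \<Rightarrow> gclass set \<Rightarrow> bool" where
  "belongs M S \<longleftrightarrow> (\<exists>C. is_decomp M S C \<and>
     (\<forall>i\<in>S. \<exists>p\<in>points M. \<exists>X Y Z. C p i X Y Z \<noteq> 0))"

definition belongs_everywhere :: "apm \<Rightarrow> gclass set \<Rightarrow> bool" where
  "belongs_everywhere M S \<longleftrightarrow> (\<exists>C. is_decomp M S C \<and>
     (\<forall>i\<in>S. \<forall>p\<in>points M. \<exists>X Y Z. C p i X Y Z \<noteq> 0))"


subsection \<open>Normal, almost paracosymplectic and paracosymplectic structures\<close>

definition nijenhuis :: "apm \<Rightarrow> vfield \<Rightarrow> vfield \<Rightarrow> vfield" where
  "nijenhuis M X Y p =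
     (let PX = (\<lambda>q. phi_at M q (X q)); PY = (\<lambda>q. phi_at M q (Y q)) in
        phi_at M p (phi_at M p (lie_bracket X Y p)) + lie_bracket PX PY p
        - phi_at M p (lie_bracket PX Y p) - phi_at M p (lie_bracket X PY p))"

definition d_eta :: "apm \<Rightarrow> vfield \<Rightarrow> vfield \<Rightarrow> pt \<Rightarrow> real" where
  "d_eta M X Y p = (nabla_eta M X Y p - nabla_eta M Y X p) / 2"

definition fundamental_form :: "apm \<Rightarrow> pt \<Rightarrow> real^3 \<Rightarrow> real^3 \<Rightarrow> real" where
  "fundamental_form M p X Y = ip M p (phi_at M p X) Y"

text \<open>Exterior derivative of the fundamental 2-form. The bracket terms of the invariant formula are
  absent because \<open>X\<close>, \<open>Y\<close>, \<open>Z\<close> are extended with constant components; the factor \<open>1/3\<close>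
  corresponds to the factor \<open>1/2\<close> in \<open>d_eta\<close>.\<close>

definition d_fundamental_form :: "apm \<Rightarrow> pt \<Rightarrow> tensor3" where
  "d_fundamental_form M p X Y Z =
     (dird (\<lambda>q. fundamental_form M q Y Z) p X + dird (\<lambda>q. fundamental_form M q Z X) p Y
      + dird (\<lambda>q. fundamental_form M q X Y) p Z) / 3"

definition normal_at :: "apm \<Rightarrow> pt \<Rightarrow> bool" where
  "normal_at M p \<longleftrightarrow> (\<forall>X Y. smooth_vfield_on (points M) X \<longrightarrow> smooth_vfield_on (points M) Y \<longrightarrow>
     nijenhuis M X Y p - (2 * d_eta M X Y p) *\<^sub>R xi M p = 0)"

definition almost_paracosymplectic_at :: "apm \<Rightarrow> pt \<Rightarrow> bool" where
  "almost_paracosymplectic_at M p \<longleftrightarrow>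
     (\<forall>X Y. smooth_vfield_on (points M) X \<longrightarrow> smooth_vfield_on (points M) Y \<longrightarrow> d_eta M X Y p = 0) \<and>
     (\<forall>X Y Z. d_fundamental_form M p X Y Z = 0)"

definition paracosymplectic_at :: "apm \<Rightarrow> pt \<Rightarrow> bool" where
  "paracosymplectic_at M p \<longleftrightarrow> almost_paracosymplectic_at M p \<and> normal_at M p"

definition normal :: "apm \<Rightarrow> bool" where
  "normal M \<longleftrightarrow> (\<forall>p\<in>points M. normal_at M p)"

definition almost_paracosymplectic :: "apm \<Rightarrow> bool" where
  "almost_paracosymplectic M \<longleftrightarrow> (\<forall>p\<in>points M. almost_paracosymplectic_at M p)"

definition paracosymplectic :: "apm \<Rightarrow> bool" where
  "paracosymplectic M \<longleftrightarrow> almost_paracosymplectic M \<and> normal M"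


section \<open>Almost paracontact metric 3-dimensional Walker manifolds\<close>

definition walker_metric :: "(pt \<Rightarrow> real) \<Rightarrow> mfield" where
  "walker_metric f p = vector [vector [0, 0, 1], vector [0, 1, 0], vector [1, 0, f p]]"

definition walker_phi ::
  "(pt \<Rightarrow> real) \<Rightarrow> (pt \<Rightarrow> real) \<Rightarrow> (pt \<Rightarrow> real) \<Rightarrow> (pt \<Rightarrow> real) \<Rightarrow> mfield" where
  "walker_phi f xi1 xi2 xi3 p =
     vector [vector [- xi2 p, xi1 p + f p * xi3 p, - f p * xi2 p],
             vector [xi3 p, 0, - xi1 p],
             vector [0, - xi3 p, xi2 p]]"

definition walker_manifold ::
  "pt set \<Rightarrow> (pt \<Rightarrow> real) \<Rightarrow> (pt \<Rightarrow> real) \<Rightarrow> (pt \<Rightarrow> real) \<Rightarrow> (pt \<Rightarrow> real) \<Rightarrow> apm" where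
  "walker_manifold U f xi1 xi2 xi3 =
     \<lparr> points = U,
       metric = walker_metric f,
       phi = walker_phi f xi1 xi2 xi3,
       xi = (\<lambda>p. vector [xi1 p, xi2 p, xi3 p]),
       eta = (\<lambda>p. vector [xi3 p, xi2 p, xi1 p + f p * xi3 p]) \<rparr>"

definition walker_data ::
  "pt set \<Rightarrow> (pt \<Rightarrow> real) \<Rightarrow> (pt \<Rightarrow> real) \<Rightarrow> (pt \<Rightarrow> real) \<Rightarrow> (pt \<Rightarrow> real) \<Rightarrow> bool" where
  "walker_data U f xi1 xi2 xi3 \<longleftrightarrow> open U \<and> U \<noteq> {} \<and>
     smooth_fun_on U f \<and> smooth_fun_on U xi1 \<and> smooth_fun_on U xi2 \<and> smooth_fun_on U xi3 \<and>
     (\<forall>p\<in>U. (xi2 p)\<^sup>2 + f p * (xi3 p)\<^sup>2 + 2 * xi1 p * xi3 p = 1)"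

end

theory Submission
  imports Defs
begin

text \<open>
  When \<open>\<xi> = \<xi>\<^sub>1 \<partial>\<^sub>x + \<partial>\<^sub>y\<close>, the covariant derivative of \<open>\<xi>\<close> is \<open>\<nabla>\<^sub>X \<xi> = c(X) \<partial>\<^sub>x\<close> for a single
  1-form \<open>c\<close>, and \<open>F = c \<otimes> (dy \<and> dz) = c \<otimes> (\<eta> \<and> dz)\<close>. The kernel of \<open>\<eta>\<close> is spanned by two null
  vectors, \<open>\<partial>\<^sub>x\<close> (with \<open>\<phi> \<partial>\<^sub>x = - \<partial>\<^sub>x\<close>) and \<open>e\<close> (with \<open>\<phi> e = e\<close>). Since \<open>F(e, \<xi>, \<partial>\<^sub>x) = 0\<close>, whereas
  the value at \<open>(e, \<xi>, \<partial>\<^sub>x)\<close> of a tensor in \<open>G\<^sub>1\<^sub>0\<close> or \<open>G\<^sub>1\<^sub>2\<close> is zero and that of a nonzero tensor in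
  \<open>G\<^sub>5\<close> or \<open>G\<^sub>6\<close> is not, neither of the last two classes can occur without the other. The remaining
  equivalences are read off from \<open>c(\<partial>\<^sub>x)\<close>, \<open>c(e)\<close>, \<open>c(\<xi>)\<close> and from the explicit form of \<open>d\<eta>\<close>, of
  the derivative of the fundamental form, and of the Nijenhuis tensor.
\<close>

section \<open>Directional derivatives and smooth functions\<close>

lemma dird_cong:
  assumes "open U" "p \<in> U" "\<And>q. q \<in> U \<Longrightarrow> h q = k q"
  shows "dird h p v = dird k p v"
proof -
  \<comment> \<open>\<open>frechet_derivative\<close> is a choice among all such \<open>D\<close>,
    so functions with the same derivatives at \<open>p\<close> get the same value, even where none
    exists.\<close>
  have "(h has_derivative D) (at p) \<longleftrightarrow> (k has_derivative D) (at p)" for D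
  proof
    show "(k has_derivative D) (at p)" if "(h has_derivative D) (at p)"
      by (rule has_derivative_transform_within_open[OF that assms])
    show "(h has_derivative D) (at p)" if "(k has_derivative D) (at p)"
      by (rule has_derivative_transform_within_open[OF that assms(1,2)]) (simp add: assms(3))
  qed
  then show ?thesis
    by (simp add: dird_def frechet_derivative_def)
qed

lemma dird_eq: "(h has_derivative D) (at p) \<Longrightarrow> dird h p v = D v"
  unfolding dird_def by (metis frechet_derivative_at)

lemma dird_const: "dird (\<lambda>q. c) p v = 0"
  by (rule dird_eq[where D="\<lambda>_. 0"]) simp

lemma has_derivative_dird: "h differentiable (at p) \<Longrightarrow> (h has_derivative dird h p) (at p)"
  by (simp add: dird_def[abs_def] frechet_derivative_works[symmetric])

lemma dird_minus:
  assumes "h differentiable (at p)"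
  shows "dird (\<lambda>q. - h q) p v = - dird h p v"
  by (rule dird_eq) (intro derivative_intros has_derivative_dird assms)

lemma dird_add:
  assumes "h differentiable (at p)" "k differentiable (at p)"
  shows "dird (\<lambda>q. h q + k q) p v = dird h p v + dird k p v"
  by (rule dird_eq) (intro derivative_intros has_derivative_dird assms)

lemma dird_diff:
  assumes "h differentiable (at p)" "k differentiable (at p)"
  shows "dird (\<lambda>q. h q - k q) p v = dird h p v - dird k p v"
  by (rule dird_eq) (intro derivative_intros has_derivative_dird assms)

lemma dird_mult:
  assumes "h differentiable (at p)" "k differentiable (at p)"
  shows "dird (\<lambda>q. h q * k q) p v = h p * dird k p v + dird h p v * k p"
  by (rule dird_eq) (intro derivative_intros has_derivative_dird assms)

lemmas dird_rules = dird_const dird_minus dird_add dird_diff dird_mult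

lemma dird_pd:
  assumes "h differentiable (at p)"
  shows "dird h p v = v $ 1 * pd 1 h p + v $ 2 * pd 2 h p + v $ 3 * pd 3 h p"
proof -
  have lin: "linear (dird h p)"
    using has_derivative_dird[OF assms] has_derivative_linear by blast
  have "v = v $ 1 *\<^sub>R axis 1 1 + v $ 2 *\<^sub>R axis 2 1 + v $ 3 *\<^sub>R axis 3 1"
    by (simp add: vec_eq_iff forall_3 axis_def)
  then have "dird h p v
      = dird h p (v $ 1 *\<^sub>R axis 1 1 + v $ 2 *\<^sub>R axis 2 1 + v $ 3 *\<^sub>R axis 3 1)"
    by simp
  then show ?thesis
    by (simp only: linear_add[OF lin] linear_scale[OF lin] pd_def real_scaleR_def)
qed

lemma smooth_fun_on_differentiable:
  "smooth_fun_on U h \<Longrightarrow> p \<in> U \<Longrightarrow> h differentiable (at p)"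
  unfolding smooth_fun_on_def by (metis foldr.simps(1) id_apply)

lemma smooth_fun_on_const: "smooth_fun_on U (\<lambda>_. c)"
proof -
  have "pd i (\<lambda>_. d) = (\<lambda>_. 0)" for i and d :: real
    by (rule ext) (simp add: pd_def dird_const)
  then have "\<exists>d. foldr pd is (\<lambda>_. c) = (\<lambda>_. d)" for "is"
    by (induction "is") auto
  then show ?thesis
    unfolding smooth_fun_on_def by (metis differentiable_const)
qed

text \<open>Makes the coordinate fields admissible test fields in \<open>normal_at\<close> and
  \<open>almost_paracosymplectic_at\<close>.\<close>

lemma smooth_vfield_on_const: "smooth_vfield_on U (\<lambda>_. X)"
  by (simp add: smooth_vfield_on_def smooth_fun_on_const)

lemma smooth_vfield_on_differentiable:
  "smooth_vfield_on U X \<Longrightarrow> p \<in> U \<Longrightarrow> (\<lambda>q. X q $ k) differentiable (at p)"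
  using smooth_fun_on_differentiable unfolding smooth_vfield_on_def by blast

section \<open>Linear algebra in dimension three\<close>

lemma matrix_vector_mult_3:
  fixes A :: "real^3^3"
  shows "A *v X = (\<chi> i. A$i$1 * X$1 + A$i$2 * X$2 + A$i$3 * X$3)"
  by (simp add: vec_eq_iff matrix_vector_mult_def sum_3)

lemma inner_3: "(X :: real^3) \<bullet> Y = X$1 * Y$1 + X$2 * Y$2 + X$3 * Y$3"
  by (simp add: inner_vec_def sum_3)

text \<open>\<open>matrix_inv\<close> is a Hilbert choice; uniqueness of two-sided inverses pins it
  to an explicit candidate.\<close>

lemma matrix_inv_unique:
  fixes A B :: "'a::semiring_1^'n^'n"
  assumes AB: "A ** B = mat 1" and BA: "B ** A = mat 1"
  shows "matrix_inv A = B"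
  unfolding matrix_inv_def
proof (rule some_equality)
  show "C = B" if "A ** C = mat 1 \<and> C ** A = mat 1" for C
    using that AB by (metis matrix_mul_assoc matrix_mul_lid matrix_mul_rid)
qed (simp add: AB BA)

section \<open>The structure and its connection in coordinates\<close>

locale walker_xi_transversal =
  fixes U :: "pt set" and f a xi2 xi3 :: "pt \<Rightarrow> real" and M :: apm
  assumes data: "walker_data U f a xi2 xi3"
    and M_def: "M = walker_manifold U f a xi2 xi3"
    and xi3_0: "p \<in> U \<Longrightarrow> xi3 p = 0"
    and xi2_1: "p \<in> U \<Longrightarrow> xi2 p = 1"
begin

lemma open_U: "open U" and U_nonempty: "U \<noteq> {}"
  using data by (auto simp: walker_data_def)

lemma points_M [simp]: "points M = U"
  by (simp add: M_def walker_manifold_def)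

lemma diff_f: "p \<in> U \<Longrightarrow> f differentiable (at p)"
  and diff_a: "p \<in> U \<Longrightarrow> a differentiable (at p)"
  using data by (auto simp: walker_data_def smooth_fun_on_differentiable)

text \<open>Twice the \<partial>x-component of the derivative of \<xi> along \<partial>z: the
  Christoffel symbols add (a f_x + f_y)/2 to the z-derivative of a.\<close>

definition w :: "pt \<Rightarrow> real" where
  "w p = 2 * pd 3 a p + a p * pd 1 f p + pd 2 f p"

definition c :: "pt \<Rightarrow> real^3 \<Rightarrow> real" where
  "c p X = pd 1 a p * X $ 1 + pd 2 a p * X $ 2 + w p / 2 * X $ 3"

lemma xi_M: "p \<in> U \<Longrightarrow> xi M p = vector [a p, 1, 0]"
  by (simp add: M_def walker_manifold_def xi2_1 xi3_0)

lemma eta_at_M: "p \<in> U \<Longrightarrow> eta_at M p X = X $ 2 + a p * X $ 3"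
  by (simp add: M_def walker_manifold_def xi2_1 xi3_0 eta_at_def inner_3)

lemma phi_at_M:
  "p \<in> U \<Longrightarrow> phi_at M p X
     = vector [- (X $ 1) + a p * X $ 2 - f p * X $ 3, - (a p * X $ 3), X $ 3]"
  by (simp add: M_def walker_manifold_def walker_phi_def xi2_1 xi3_0 phi_at_def
      matrix_vector_mult_3 vec_eq_iff forall_3)

lemma metric_M: "metric M = walker_metric f"
  by (simp add: M_def walker_manifold_def)

lemma ip_M: "ip M p X Y = X $ 1 * Y $ 3 + X $ 2 * Y $ 2 + X $ 3 * (Y $ 1 + f p * Y $ 3)"
  by (simp add: ip_def metric_M walker_metric_def inner_3 matrix_vector_mult_3)

lemma ginv_M:
  "ginv M p i j
     = (vector [vector [- f p, 0, 1], vector [0, 1, 0], vector [1, 0, 0]] :: real^3^3) $ i $ j"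
proof -
  have "matrix_inv (metric M p) = vector [vector [- f p, 0, 1], vector [0, 1, 0], vector [1, 0, 0]]"
    by (rule matrix_inv_unique)
      (simp_all add: metric_M walker_metric_def vec_eq_iff forall_3 matrix_matrix_mult_def sum_3
        mat_def)
  then show ?thesis
    by (simp add: ginv_def)
qed

lemma christoffel_M:
  "christoffel M p 1 i j =
     (if (i, j) = (1, 3) \<or> (i, j) = (3, 1) then pd 1 f p / 2
      else if (i, j) = (2, 3) \<or> (i, j) = (3, 2) then pd 2 f p / 2
      else if (i, j) = (3, 3) then (f p * pd 1 f p + pd 3 f p) / 2 else 0)"
  "christoffel M p 2 i j = (if (i, j) = (3, 3) then - pd 2 f p / 2 else 0)"
  "christoffel M p 3 i j = (if (i, j) = (3, 3) then - pd 1 f p / 2 else 0)"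
  using exhaust_3[of i] exhaust_3[of j]
  by (auto simp: christoffel_def sum_3 ginv_M metric_M walker_metric_def
      pd_def dird_const)

lemma nabla_M:
  "nabla M X Y p = vector
    [dird (\<lambda>q. Y q $ 1) p (X p)
       + (pd 1 f p * (X p $ 1 * Y p $ 3 + X p $ 3 * Y p $ 1)
        + pd 2 f p * (X p $ 2 * Y p $ 3 + X p $ 3 * Y p $ 2)
        + (f p * pd 1 f p + pd 3 f p) * X p $ 3 * Y p $ 3) / 2,
     dird (\<lambda>q. Y q $ 2) p (X p) - pd 2 f p / 2 * X p $ 3 * Y p $ 3,
     dird (\<lambda>q. Y q $ 3) p (X p) - pd 1 f p / 2 * X p $ 3 * Y p $ 3]"
  by (simp add: nabla_def vec_eq_iff forall_3 sum_3 christoffel_M algebra_simps add_divide_distrib)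

text \<open>The formula for \<phi> holds only on \<open>U\<close>, so it enters under the derivative
  through \<open>dird_cong\<close>. Components of \<open>Y\<close> may vary, as the brackets in
  \<open>nijenhuis\<close> require.\<close>

lemma dird_phi_at_M:
  assumes "p \<in> U" "\<And>k. (\<lambda>q. Y q $ k) differentiable (at p)"
  shows "dird (\<lambda>q. phi_at M q (Y q) $ 1) p v
      = - dird (\<lambda>q. Y q $ 1) p v + a p * dird (\<lambda>q. Y q $ 2) p v + dird a p v * Y p $ 2
        - f p * dird (\<lambda>q. Y q $ 3) p v - dird f p v * Y p $ 3"
    and "dird (\<lambda>q. phi_at M q (Y q) $ 2) p v
      = - a p * dird (\<lambda>q. Y q $ 3) p v - dird a p v * Y p $ 3"
    and "dird (\<lambda>q. phi_at M q (Y q) $ 3) p v = dird (\<lambda>q. Y q $ 3) p v"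
proof -
  note cong = dird_cong[OF open_U assms(1), where v = v]
  have "dird (\<lambda>q. phi_at M q (Y q) $ 1) p v
      = dird (\<lambda>q. - (Y q $ 1) + a q * Y q $ 2 - f q * Y q $ 3) p v"
    by (rule cong) (simp add: phi_at_M)
  then show "dird (\<lambda>q. phi_at M q (Y q) $ 1) p v
      = - dird (\<lambda>q. Y q $ 1) p v + a p * dird (\<lambda>q. Y q $ 2) p v + dird a p v * Y p $ 2
        - f p * dird (\<lambda>q. Y q $ 3) p v - dird f p v * Y p $ 3"
    using assms by (simp add: dird_rules diff_a diff_f)
  have "dird (\<lambda>q. phi_at M q (Y q) $ 2) p v = dird (\<lambda>q. - (a q * Y q $ 3)) p v"
    by (rule cong) (simp add: phi_at_M)
  then show "dird (\<lambda>q. phi_at M q (Y q) $ 2) p v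
      = - a p * dird (\<lambda>q. Y q $ 3) p v - dird a p v * Y p $ 3"
    using assms by (simp add: dird_rules diff_a)
  show "dird (\<lambda>q. phi_at M q (Y q) $ 3) p v = dird (\<lambda>q. Y q $ 3) p v"
    by (rule cong) (simp add: phi_at_M)
qed

section \<open>The tensor \<open>F\<close>, the exterior derivatives and the Nijenhuis
  tensor\<close>

lemma F_M:
  assumes "p \<in> U"
  shows "F M p X Y Z = c p X * (Y $ 2 * Z $ 3 - Y $ 3 * Z $ 2)"
  using assms
  by (simp add: F_def nabla_phi_def nabla_M ip_M dird_phi_at_M phi_at_M dird_const dird_pd diff_a
      diff_f c_def w_def)
    (simp add: field_simps)

text \<open>On \<open>U\<close>, \<eta> = dy + a dz, so twice \<open>d_eta\<close> is the wedge of
  da and dz; the connection terms cancel by symmetry of the Christoffel symbols.\<close>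

lemma d_eta_M:
  assumes "p \<in> U" "smooth_vfield_on U X" "smooth_vfield_on U Y"
  shows "2 * d_eta M X Y p = pd 1 a p * (X p $ 1 * Y p $ 3 - X p $ 3 * Y p $ 1)
     + pd 2 a p * (X p $ 2 * Y p $ 3 - X p $ 3 * Y p $ 2)"
proof -
  have "dird (\<lambda>q. eta_at M q (Z q)) p v
      = dird (\<lambda>q. Z q $ 2) p v + a p * dird (\<lambda>q. Z q $ 3) p v + dird a p v * Z p $ 3"
    if "smooth_vfield_on U Z" for Z v
  proof -
    have "dird (\<lambda>q. eta_at M q (Z q)) p v = dird (\<lambda>q. Z q $ 2 + a q * Z q $ 3) p v"
      by (rule dird_cong[OF open_U assms(1)]) (simp add: eta_at_M)
    then show ?thesis
      using that assms(1) by (simp add: dird_rules diff_a smooth_vfield_on_differentiable)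
  qed
  then show ?thesis
    using assms
    by (simp add: d_eta_def nabla_eta_def nabla_M eta_at_M dird_pd diff_a) (simp add: field_simps)
qed

text \<open>The terms with f cancel in g(\<phi>A, B), and a multiplies only the wedge of dy and dz.
  Hence only the x-derivative of a survives, times the volume form.\<close>

lemma d_fundamental_form_M:
  assumes "p \<in> U"
  shows "d_fundamental_form M p X Y Z = (pd 1 a p / 3) *
    det (vector [X, Y, Z] :: real^3^3)"
proof -
  have "dird (\<lambda>q. fundamental_form M q A B) p v
      = dird a p v * (A $ 2 * B $ 3 - A $ 3 * B $ 2)" for A B v
  proof -
    have "dird (\<lambda>q. fundamental_form M q A B) p v
        = dird (\<lambda>q. a q * (A $ 2 * B $ 3 - A $ 3 * B $ 2) + (A $ 3 * B $ 1 - A $ 1 * B $ 3)) p v"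
      by (rule dird_cong[OF open_U assms])
        (simp add: fundamental_form_def ip_M phi_at_M algebra_simps)
    then show ?thesis
      using assms by (simp add: dird_rules diff_a)
  qed
  then show ?thesis
    using assms by (simp add: d_fundamental_form_def det_3 dird_pd diff_a) (simp add: field_simps)
qed

text \<open>The expression is tensorial, so all derivatives of \<open>X\<close> and \<open>Y\<close>
  cancel. It is alternating and vanishes on pairs containing \<partial>x, which leaves its value on
  (\<partial>y, \<partial>z).\<close>

lemma nijenhuis_M:
  assumes "p \<in> U" "smooth_vfield_on U X" "smooth_vfield_on U Y"
  shows "nijenhuis M X Y p - (2 * d_eta M X Y p) *\<^sub>R xi M p
    = (X p $ 2 * Y p $ 3 - X p $ 3 * Y p $ 2) *\<^sub>R
        vector [- w p + f p * pd 1 a p + a p * pd 2 a p, - (a p * pd 1 a p + pd 2 a p), 0]"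
proof -
  note diff = smooth_vfield_on_differentiable[OF assms(2) assms(1)]
    smooth_vfield_on_differentiable[OF assms(3) assms(1)]
  show ?thesis
    using assms(1)
    by (simp add: nijenhuis_def lie_bracket_def d_eta_M[OF assms] xi_M vec_eq_iff forall_3 Let_def)
      (simp add: dird_phi_at_M phi_at_M dird_pd diff diff_a diff_f w_def algebra_simps)
qed

section \<open>Pointwise criteria for the special structures\<close>

lemma normal_at_iff:
  assumes "p \<in> U"
  shows "normal_at M p \<longleftrightarrow> pd 2 a p = - a p * pd 1 a p \<and> w p + pd 1 a p * ((a p)\<^sup>2 - f p) = 0"
proof -
  let ?V = "vector [- w p + f p * pd 1 a p + a p * pd 2 a p, - (a p * pd 1 a p + pd 2 a p), 0]
    :: real^3"
  have "normal_at M p \<longleftrightarrow> ?V = 0"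
  proof
    assume N: "normal_at M p"
    have "nijenhuis M (\<lambda>_. axis 2 1) (\<lambda>_. axis 3 1) p
        - (2 * d_eta M (\<lambda>_. axis 2 1) (\<lambda>_. axis 3 1) p) *\<^sub>R xi M p = 0"
      using N by (simp add: normal_at_def smooth_vfield_on_const)
    then show "?V = 0"
      by (simp add: nijenhuis_M[OF assms smooth_vfield_on_const smooth_vfield_on_const] axis_def)
  next
    assume "?V = 0"
    then show "normal_at M p"
      by (simp add: normal_at_def nijenhuis_M[OF assms])
  qed
  moreover have "?V = 0 \<longleftrightarrow> w p = f p * pd 1 a p + a p * pd 2 a p \<and> pd 2 a p = - a p * pd 1 a p"
    by (auto simp: vec_eq_iff forall_3)
  ultimately show ?thesis
    by (auto simp: power2_eq_square algebra_simps)
qed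

text \<open>The values of d\<eta> on (\<partial>x, \<partial>z) and (\<partial>y, \<partial>z) give
  the two equations; conversely, no other derivatives occur in d\<eta> or in the derivative of the
  fundamental form.\<close>

lemma almost_paracosymplectic_at_iff:
  assumes "p \<in> U"
  shows "almost_paracosymplectic_at M p \<longleftrightarrow> pd 1 a p = 0 \<and> pd 2 a p = 0"
proof
  assume "almost_paracosymplectic_at M p"
  then have d_eta: "2 * d_eta M (\<lambda>_. X) (\<lambda>_. Y) p = 0" for X Y
    by (simp add: almost_paracosymplectic_at_def smooth_vfield_on_const)
  note d_eta' = d_eta[unfolded d_eta_M[OF assms smooth_vfield_on_const smooth_vfield_on_const]]
  show "pd 1 a p = 0 \<and> pd 2 a p = 0"
    using d_eta'[of "axis 1 1" "axis 3 1"] d_eta'[of "axis 2 1" "axis 3 1"] by (simp add: axis_def)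
next
  assume "pd 1 a p = 0 \<and> pd 2 a p = 0"
  then have "2 * d_eta M X Y p = 0" if "smooth_vfield_on U X" "smooth_vfield_on U Y" for X Y
    using d_eta_M[OF assms that] by simp
  with \<open>pd 1 a p = 0 \<and> pd 2 a p = 0\<close> show "almost_paracosymplectic_at M p"
    by (simp add: almost_paracosymplectic_at_def d_fundamental_form_M[OF assms])
qed

lemma paracosymplectic_at_iff:
  assumes "p \<in> U"
  shows "paracosymplectic_at M p \<longleftrightarrow> pd 1 a p = 0 \<and> pd 2 a p = 0 \<and> w p = 0"
  by (auto simp: paracosymplectic_at_def almost_paracosymplectic_at_iff[OF assms]
      normal_at_iff[OF assms])

lemma paracosymplectic_iff: "paracosymplectic M \<longleftrightarrow> (\<forall>p\<in>U. paracosymplectic_at M p)"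
  by (auto simp: paracosymplectic_def almost_paracosymplectic_def normal_def
      paracosymplectic_at_def)

section \<open>The null vector \<open>e\<close> and membership of \<open>F\<close> in a single
  class\<close>

definition e :: "pt \<Rightarrow> real^3" where
  "e p = vector [- ((a p)\<^sup>2 + f p) / 2, - a p, 1]"

lemma trilinear_F:
  assumes "p \<in> U"
  shows "trilinear (F M p)"
  unfolding trilinear_def F_M[OF assms] c_def
  by (intro conjI allI linearI) (simp_all add: algebra_simps)

text \<open>The class condition says that \<open>c\<close> is a multiple of \<eta>, that is,
  vanishes on \<partial>x and \<open>e\<close>. Given c(\<partial>x) = 0, the equation c(e) = 0
  becomes the second one.\<close>

lemma F_in_G12_iff:
  assumes "p \<in> U"
  shows "in_gclass M p G12 (F M p) \<longleftrightarrow> pd 1 a p = 0 \<and> w p = 2 * a p * pd 2 a p"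
proof
  assume "in_gclass M p G12 (F M p)"
  then have G12: "F M p X Y Z = eta_at M p X *
      (eta_at M p Y * F M p (xi M p) (xi M p) Z - eta_at M p Z * F M p (xi M p) (xi M p) Y)"
    for X Y Z
    unfolding in_gclass.simps by blast
  show "pd 1 a p = 0 \<and> w p = 2 * a p * pd 2 a p"
    using G12[of "axis 1 1" "axis 2 1" "axis 3 1"] G12[of "e p" "axis 2 1" "axis 3 1"]
    by (auto simp: F_M[OF assms] eta_at_M[OF assms] xi_M[OF assms] c_def e_def axis_def)
next
  assume "pd 1 a p = 0 \<and> w p = 2 * a p * pd 2 a p"
  then show "in_gclass M p G12 (F M p)"
    by (simp add: trilinear_F[OF assms] F_M[OF assms] eta_at_M[OF assms] xi_M[OF assms] c_def
        algebra_simps)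
qed

lemma F_nonzero_iff:
  assumes "p \<in> U"
  shows "(\<exists>X Y Z. F M p X Y Z \<noteq> 0) \<longleftrightarrow> pd 1 a p \<noteq> 0 \<or> pd 2 a p \<noteq> 0 \<or> w p \<noteq> 0"
proof
  have "F M p (axis i 1) (axis 2 1) (axis 3 1) = c p (axis i 1)" for i
    by (simp add: F_M[OF assms] axis_def)
  then have "F M p (axis 1 1) (axis 2 1) (axis 3 1) = pd 1 a p"
    "F M p (axis 2 1) (axis 2 1) (axis 3 1) = pd 2 a p"
    "F M p (axis 3 1) (axis 2 1) (axis 3 1) = w p / 2"
    by (simp_all add: c_def axis_def)
  then show "pd 1 a p \<noteq> 0 \<or> pd 2 a p \<noteq> 0 \<or> w p \<noteq> 0 \<Longrightarrow> \<exists>X Y Z. F M p X Y Z \<noteq> 0"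
    by (metis divide_eq_0_iff zero_neq_numeral)
qed (auto simp: F_M[OF assms] c_def)

text \<open>With one class the sum has one term, which must be \<open>F\<close>; this eliminates the
  choice of \<open>C\<close> from the membership predicates.\<close>

lemma is_decomp_singleton_iff:
  "is_decomp M {i} C \<longleftrightarrow> (\<forall>p\<in>U. C p i = F M p \<and> in_gclass M p i (F M p))"
  by (auto simp: is_decomp_def fun_eq_iff[symmetric])

lemma belongs_singleton_iff:
  "belongs M {i} \<longleftrightarrow>
     (\<forall>p\<in>U. in_gclass M p i (F M p)) \<and> (\<exists>p\<in>U. \<exists>X Y Z. F M p X Y Z \<noteq> 0)"
  unfolding belongs_def is_decomp_singleton_iff by force

lemma belongs_everywhere_singleton_iff:
  "belongs_everywhere M {i} \<longleftrightarrow>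
     (\<forall>p\<in>U. in_gclass M p i (F M p) \<and> (\<exists>X Y Z. F M p X Y Z \<noteq> 0))"
  unfolding belongs_everywhere_def is_decomp_singleton_iff by force

section \<open>The four classes evaluated at (\<open>e\<close>, \<xi>, \<partial>x)\<close>

lemma G5_component:
  assumes "p \<in> U" "in_gclass M p G5 T"
  shows "T (e p) (xi M p) (axis 1 1) = - theta M p T (xi M p) / 2"
proof -
  have "T X Y Z = theta M p T (xi M p) / 2 *
        (eta_at M p Y * ip M p (phi_at M p X) (phi_at M p Z)
         - eta_at M p Z * ip M p (phi_at M p X) (phi_at M p Y))" for X Y Z
    using assms(2) unfolding in_gclass.simps by blast
  \<comment> \<open>Here \<eta>(\<xi>) = 1, \<eta>(\<partial>x) = 0 and g(\<phi>e,
    \<phi>\<partial>x) = - g(e, \<partial>x) = -1.\<close>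
  from this[of "e p" "xi M p" "axis 1 1"] show ?thesis
    by (simp add: eta_at_M[OF assms(1)] phi_at_M[OF assms(1)] ip_M xi_M[OF assms(1)] e_def axis_def)
qed

lemma G6_component:
  assumes "p \<in> U" "in_gclass M p G6 T"
  shows "T (e p) (xi M p) (axis 1 1) = theta_star M p T (xi M p) / 2"
proof -
  have "T X Y Z = - (theta_star M p T (xi M p) / 2) *
        (eta_at M p Y * ip M p X (phi_at M p Z) - eta_at M p Z * ip M p X (phi_at M p Y))" for X Y Z
    using assms(2) unfolding in_gclass.simps by blast
  from this[of "e p" "xi M p" "axis 1 1"] show ?thesis
    by (simp add: eta_at_M[OF assms(1)] phi_at_M[OF assms(1)] ip_M xi_M[OF assms(1)] e_def axis_def)
qed

lemma G10_component:
  assumes "p \<in> U" "in_gclass M p G10 T"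
  shows "T (e p) (xi M p) (axis 1 1) = 0"
proof -
  have T: "T X Y Z = - eta_at M p Y * T X Z (xi M p) + eta_at M p Z * T X Y (xi M p)"
    "T X Y (xi M p) = T Y X (xi M p)"
    "T Y X (xi M p) = T (phi_at M p X) (phi_at M p Y) (xi M p)" for X Y Z
    using assms(2) unfolding in_gclass.simps by blast+
  have lin: "linear (\<lambda>Y. T X Y Z)" for X Z
    using assms(2) unfolding in_gclass.simps trilinear_def by blast
  \<comment> \<open>The entries of \<open>e\<close> are the solution of \<phi>e = e with last entry
    1.\<close>
  have "phi_at M p (e p) = e p" "phi_at M p (axis 1 1) = - axis 1 1"
    using assms(1)
    by (simp_all add: phi_at_M e_def axis_def vec_eq_iff forall_3 power2_eq_square field_simps)
  \<comment> \<open>Swapping the first two arguments preserves the value, while applying \<phi> to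
    both changes its sign, since the eigenvalues 1 and -1 multiply to -1.\<close>
  then have "T (e p) (axis 1 1) (xi M p) = - T (e p) (axis 1 1) (xi M p)"
    using T(2)[of "e p" "axis 1 1"] T(3)[of "axis 1 1" "e p"]
      linear_neg[OF lin[of "e p" "xi M p"], of "axis 1 1"] by simp
  then show ?thesis
    using T(1)[of "e p" "xi M p" "axis 1 1"] assms(1)
    by (simp add: eta_at_M xi_M axis_def)
qed

lemma G12_component:
  assumes "p \<in> U" "in_gclass M p G12 T"
  shows "T (e p) Y Z = 0"
proof -
  have "eta_at M p (e p) = 0"
    using assms(1) by (simp add: eta_at_M e_def)
  have "T X Y Z = eta_at M p X *
        (eta_at M p Y * T (xi M p) (xi M p) Z - eta_at M p Z * T (xi M p) (xi M p) Y)" for X Y Z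
    using assms(2) unfolding in_gclass.simps by blast
  from this[of "e p" Y Z] show ?thesis
    unfolding \<open>eta_at M p (e p) = 0\<close> by simp
qed

text \<open>Neither \<xi> nor \<partial>x has a z-component, so \<open>F\<close> vanishes at
  (\<open>e\<close>, \<xi>, \<partial>x). The only summand that could contribute there is the one in
  class \<open>i\<close>; its value is, up to sign, half of the trace that multiplies the whole
  tensor.\<close>

lemma trace_component_eq_0:
  assumes "is_decomp M S C" "p \<in> U" "i \<in> S" "i = G5 \<or> i = G6" "S \<subseteq> {i, G10, G12}"
  shows "C p i X Y Z = 0"
proof -
  have C: "in_gclass M p j (C p j)" if "j \<in> S" for j
    using assms(1,2) that by (simp add: is_decomp_def)
  have "finite S"
    using assms(5) by (rule finite_subset) simp
  have "F M p (e p) (xi M p) (axis 1 1) = 0"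
    using assms(2) by (simp add: F_M xi_M axis_def)
  moreover have "F M p (e p) (xi M p) (axis 1 1) = (\<Sum>j\<in>S. C p j (e p) (xi M p) (axis 1 1))"
    using assms(1,2) by (simp add: is_decomp_def)
  moreover have "(\<Sum>j\<in>S - {i}. C p j (e p) (xi M p) (axis 1 1)) = 0"
  proof (intro sum.neutral ballI)
    fix j assume j: "j \<in> S - {i}"
    then have "j = G10 \<or> j = G12"
      using assms(5) by auto
    then show "C p j (e p) (xi M p) (axis 1 1) = 0"
      using C[of j] j G10_component[OF assms(2)] G12_component[OF assms(2)] by blast
  qed
  ultimately have i_0: "C p i (e p) (xi M p) (axis 1 1) = 0"
    using sum.remove[OF \<open>finite S\<close> assms(3), of "\<lambda>j. C p j (e p) (xi M p) (axis 1 1)"]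
    by linarith
  show ?thesis
    using assms(4)
  proof
    assume "i = G5"
    with C[OF assms(3)] have in_class: "in_gclass M p G5 (C p i)"
      by (simp only:)
    have "C p i X Y Z = theta M p (C p i) (xi M p) / 2 *
        (eta_at M p Y * ip M p (phi_at M p X) (phi_at M p Z)
         - eta_at M p Z * ip M p (phi_at M p X) (phi_at M p Y))"
      using in_class unfolding in_gclass.simps by blast
    moreover have "theta M p (C p i) (xi M p) = 0"
      using G5_component[OF assms(2) in_class] i_0 by simp
    ultimately show ?thesis
      by simp
  next
    assume "i = G6"
    with C[OF assms(3)] have in_class: "in_gclass M p G6 (C p i)"
      by (simp only:)
    have "C p i X Y Z = - (theta_star M p (C p i) (xi M p) / 2) *
        (eta_at M p Y * ip M p X (phi_at M p Z) - eta_at M p Z * ip M p X (phi_at M p Y))"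
      using in_class unfolding in_gclass.simps by blast
    moreover have "theta_star M p (C p i) (xi M p) = 0"
      using G6_component[OF assms(2) in_class] i_0 by simp
    ultimately show ?thesis
      by simp
  qed
qed

lemma not_belongs:
  assumes "i \<in> S" "i = G5 \<or> i = G6" "S \<subseteq> {i, G10, G12}"
  shows "\<not> belongs M S" "\<not> belongs_everywhere M S"
  using trace_component_eq_0[OF _ _ assms] U_nonempty assms(1)
  unfolding belongs_def belongs_everywhere_def points_M by blast+

end

section \<open>Assembly of the equivalences\<close>

theorem theorem4p4:
  fixes U :: "(real^3) set" and f xi1 xi2 xi3 :: "real^3 \<Rightarrow> real" and M :: apm
  assumes "walker_data U f xi1 xi2 xi3"
    and "M = walker_manifold U f xi1 xi2 xi3"
    and "\<forall>p\<in>U. xi3 p = 0"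
    and "\<forall>p\<in>U. xi2 p = 1"
  shows
   "\<comment> \<open>(i)\<close>
    (\<forall>S \<in> {{G5}, {G5, G10}, {G5, G12}, {G5, G10, G12},
            {G6}, {G6, G10}, {G6, G12}, {G6, G10, G12}}.
        \<not> belongs M S \<and> \<not> belongs_everywhere M S)
    \<and> \<comment> \<open>(ii)\<close>
    (paracosymplectic M \<longleftrightarrow>
      (\<forall>p\<in>U. pd 1 xi1 p = 0 \<and> pd 2 xi1 p = 0
         \<and> 2 * pd 3 xi1 p + xi1 p * pd 1 f p + pd 2 f p = 0))
    \<and> \<comment> \<open>(iii), nonzero meaning: not identically zero\<close>
    (normal M \<and> \<not> paracosymplectic M \<longleftrightarrow>
      (\<exists>p\<in>U. pd 1 xi1 p \<noteq> 0)
      \<and> (\<forall>p\<in>U. pd 2 xi1 p = - xi1 p * pd 1 xi1 p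
         \<and> 2 * pd 3 xi1 p + xi1 p * pd 1 f p + pd 2 f p
             + pd 1 xi1 p * ((xi1 p)\<^sup>2 - f p) = 0))
    \<and> \<comment> \<open>(iii), nonzero meaning: nowhere zero\<close>
    (normal M \<and> (\<forall>p\<in>U. \<not> paracosymplectic_at M p) \<longleftrightarrow>
      (\<forall>p\<in>U. pd 1 xi1 p \<noteq> 0
         \<and> pd 2 xi1 p = - xi1 p * pd 1 xi1 p
         \<and> 2 * pd 3 xi1 p + xi1 p * pd 1 f p + pd 2 f p
             + pd 1 xi1 p * ((xi1 p)\<^sup>2 - f p) = 0))
    \<and> \<comment> \<open>(iv), nonzero meaning: not identically zero\<close>
    (almost_paracosymplectic M \<and> \<not> paracosymplectic M \<longleftrightarrow>
      (\<forall>p\<in>U. pd 1 xi1 p = 0 \<and> pd 2 xi1 p = 0)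
      \<and> (\<exists>p\<in>U. 2 * pd 3 xi1 p + xi1 p * pd 1 f p + pd 2 f p \<noteq> 0))
    \<and> \<comment> \<open>(iv), nonzero meaning: nowhere zero\<close>
    (almost_paracosymplectic M \<and> (\<forall>p\<in>U. \<not> paracosymplectic_at M p) \<longleftrightarrow>
      (\<forall>p\<in>U. pd 1 xi1 p = 0 \<and> pd 2 xi1 p = 0
         \<and> 2 * pd 3 xi1 p + xi1 p * pd 1 f p + pd 2 f p \<noteq> 0))
    \<and> \<comment> \<open>(v), nonzero meaning: not identically zero\<close>
    (belongs M {G12} \<longleftrightarrow>
      (\<exists>p\<in>U. pd 2 xi1 p \<noteq> 0)
      \<and> (\<forall>p\<in>U. pd 1 xi1 p = 0
         \<and> 2 * xi1 p * pd 2 xi1 p - 2 * pd 3 xi1 p - xi1 p * pd 1 f p - pd 2 f p = 0))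
    \<and> \<comment> \<open>(v), nonzero meaning: nowhere zero\<close>
    (belongs_everywhere M {G12} \<longleftrightarrow>
      (\<forall>p\<in>U. pd 1 xi1 p = 0 \<and> pd 2 xi1 p \<noteq> 0
         \<and> 2 * xi1 p * pd 2 xi1 p - 2 * pd 3 xi1 p - xi1 p * pd 1 f p - pd 2 f p = 0))"
proof -
  interpret walker_xi_transversal U f xi1 xi2 xi3 M
    using assms by unfold_locales auto
  have i: "\<not> belongs M S \<and> \<not> belongs_everywhere M S"
    if S: "S \<in> {{G5}, {G5, G10}, {G5, G12}, {G5, G10, G12},
                {G6}, {G6, G10}, {G6, G12}, {G6, G10, G12}}" for S
  proof -
    from S consider "G5 \<in> S" "S \<subseteq> {G5, G10, G12}" | "G6 \<in> S" "S \<subseteq> {G6, G10, G12}"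
      by auto
    then show ?thesis
      using not_belongs by cases blast+
  qed
  have w_eq: "2 * xi1 p * pd 2 xi1 p - 2 * pd 3 xi1 p - xi1 p * pd 1 f p - pd 2 f p = 0
      \<longleftrightarrow> w p = 2 * xi1 p * pd 2 xi1 p" for p
    by (auto simp: w_def)
  \<comment> \<open>Normality makes the y-derivative of a and \<open>w\<close> multiples of the
    x-derivative, so that one derivative decides. The next two facts likewise isolate a single
    deciding quantity, which serves both readings of "nonzero".\<close>
  have normal_case: "paracosymplectic_at M p \<longleftrightarrow> pd 1 xi1 p = 0"
    if "p \<in> U" "normal_at M p" for p
    using that by (auto simp: paracosymplectic_at_iff normal_at_iff)
  have almost_case: "paracosymplectic_at M p \<longleftrightarrow> w p = 0"
    if "p \<in> U" "almost_paracosymplectic_at M p" for p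
    using that by (auto simp: paracosymplectic_at_iff almost_paracosymplectic_at_iff)
  have G12_case: "(\<exists>X Y Z. F M p X Y Z \<noteq> 0) \<longleftrightarrow> pd 2 xi1 p \<noteq> 0"
    if "p \<in> U" "in_gclass M p G12 (F M p)" for p
    using F_in_G12_iff[OF that(1)] F_nonzero_iff[OF that(1)] that(2) by (auto simp del: in_gclass.simps)
  show ?thesis
    unfolding w_eq w_def[symmetric] belongs_singleton_iff belongs_everywhere_singleton_iff
      paracosymplectic_iff normal_def almost_paracosymplectic_def points_M
    apply (intro conjI)
    subgoal using i by blast
    subgoal using paracosymplectic_at_iff by blast
    subgoal using normal_at_iff normal_case by blast
    subgoal using normal_at_iff normal_case by blast
    subgoal using almost_paracosymplectic_at_iff almost_case by blast
    subgoal using almost_paracosymplectic_at_iff almost_case by blast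
    subgoal using F_in_G12_iff G12_case by blast
    subgoal using F_in_G12_iff G12_case by blast
    done
qed

end
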